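(* Let $f:\mathbb{R}\times\mathbb{R}^n\to\mathbb{R}^n$ be a function and let $F:\mathbb{R}^n\rightrightarrows\mathbb{R}^n$ be a set-valued map with closed graph. Let $(\bar t,\bar u)\in\mathbb{R}\times\mathbb{R}^n$ and let $h:\mathbb{R}^n\to\mathbb{R}^n$ be a strict estimator of $f$ with respect to $u$ uniformly in $t$ at $(\bar t,\bar u)$ with constant $\mu\ge 0$. Consider the set-valued maps $$G_{\bar t,\bar u}(v)=h(v)+F(v),\qquad G_{\bar t}(v)=f(\bar t,v)+F(v),\qquad v\in\mathbb{R}^n.$$ Then $G_{\bar t,\bar u}$ is strongly metrically regular at $\bar u$ for $0$ if and only if $G_{\bar t}$ is strongly metrically regular at $\bar u$ for $0$, provided that the regularity modulus at $\bar u$ for $0$ of each of the two maps, multiplied by $\mu$, is less than $1$ (if $\mu=0$ this proviso is regarded as satisfied).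
   Context: A set-valued map $H:\mathbb{R}^n\rightrightarrows\mathbb{R}^n$ assigns to each $x$ a (possibly empty) subset $H(x)$; $\operatorname{gph}H=\{(x,y): y\in H(x)\}$, $H^{-1}(y)=\{x: y\in H(x)\}$. $\mathbb{B}_r(x)$ is the closed ball of radius $r$ centred at $x$. $H$ is strongly metrically regular at $\bar x$ for $\bar y$ if $(\bar x,\bar y)\in\operatorname{gph}H$ and there are neighborhoods $U$ of $\bar x$ and $V$ of $\bar y$ such that $V\ni y\mapsto H^{-1}(y)\cap U$ is single-valued (exactly one point for every $y \in V$) and Lipschitz continuous on $V$. The regularity modulus $\operatorname{reg}(H;\bar x|\bar y)$ is the infimum of all $\kappa\ge0$ for which there exist neighborhoods $U$ of $\bar x$, $V$ of $\bar y$ with $d(x,H^{-1}(y))\le\kappa\, d(y,H(x))$ for all $(x,y)\in U\times V$ (equal to $+\infty$ if there is no such $\kappa$). For a strongly metrically regular map it equals the Lipschitz modulus at $\bar y$ of the single-valued localization of $H^{-1}$ around $\bar y$ for $\bar x$ (the infimum of Lipschitz constants over all neighborhoods of $\bar y$). $h$ is a strict estimator of $f$ with respect to $u$ uniformly in $t$ at $(\bar t,\bar u)$ with constant $\mu$ if $h(\bar u)=f(\bar t,\bar u)$ and, with $e(t,u)=f(t,u)-h(u)$, $$\limsup_{t\to\bar t,\ u,u'\to\bar u,\ u\ne u'}\frac{\|e(t,u)-e(t,u')\|}{\|u-u'\|}\le\mu<\infty .$$ *)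

theory Defs
  imports "HOL-Analysis.Analysis"
begin

type_synonym ('a, 'b) setmap = "'a \<Rightarrow> 'b set"

definition gph :: "('a, 'b) setmap \<Rightarrow> ('a \<times> 'b) set" where
  "gph H = {(x, y). y \<in> H x}"

definition inv_map :: "('a, 'b) setmap \<Rightarrow> ('b, 'a) setmap" where
  "inv_map H y = {x. y \<in> H x}"

definition fun_plus_map :: "('a \<Rightarrow> 'b::plus) \<Rightarrow> ('a, 'b) setmap \<Rightarrow> ('a, 'b) setmap" where
  "fun_plus_map g F v = {g v + w | w. w \<in> F v}"

(* Neighbourhoods need not be open. *)
definition nbhd :: "'a::topological_space set \<Rightarrow> 'a \<Rightarrow> bool" where
  "nbhd U x \<longleftrightarrow> x \<in> interior U"

definition strongly_metrically_regular ::
    "('a::metric_space, 'b::metric_space) setmap \<Rightarrow> 'a \<Rightarrow> 'b \<Rightarrow> bool" where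
  "strongly_metrically_regular H xbar ybar \<longleftrightarrow>
     (xbar, ybar) \<in> gph H \<and>
     (\<exists>U V s. nbhd U xbar \<and> nbhd V ybar \<and>
        (\<forall>y\<in>V. inv_map H y \<inter> U = {s y}) \<and>
        (\<exists>L. L-lipschitz_on V s))"

(* The library's infdist gives 0 for the empty set; here the distance to the empty set is \<infinity>. *)
definition edist_set :: "'a::metric_space \<Rightarrow> 'a set \<Rightarrow> ereal" where
  "edist_set x A = (INF a\<in>A. ereal (dist x a))"

(* In ereal, 0 * \<infinity> = 0. This affects only whether kappa = 0 is itself admissible, not the infimum:
   if the inequality holds for kappa = 0 under either convention for 0 * \<infinity>, it holds for every
   kappa > 0. The infimum of the empty set is \<infinity>. *)
definition reg_modulus ::
    "('a::metric_space, 'b::metric_space) setmap \<Rightarrow> 'a \<Rightarrow> 'b \<Rightarrow> ereal" where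
  "reg_modulus H xbar ybar =
     Inf {ereal \<kappa> | \<kappa>. \<kappa> \<ge> 0 \<and>
       (\<exists>U V. nbhd U xbar \<and> nbhd V ybar \<and>
          (\<forall>x\<in>U. \<forall>y\<in>V. edist_set x (inv_map H y) \<le> ereal \<kappa> * edist_set y (H x)))}"

(* The limit is along all triples (t, u, u') with u \<noteq> u'; the values t = tbar, u = ubar and
   u' = ubar are allowed. *)
definition strict_estimator ::
    "('t::topological_space \<times> 'a::real_normed_vector \<Rightarrow> 'b::real_normed_vector) \<Rightarrow>
     ('a \<Rightarrow> 'b) \<Rightarrow> 't \<Rightarrow> 'a \<Rightarrow> real \<Rightarrow> bool" where
  "strict_estimator f h tbar ubar \<mu> \<longleftrightarrow>
     h ubar = f (tbar, ubar) \<and>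
     (let e = (\<lambda>t u. f (t, u) - h u) in
        Limsup (at (tbar, ubar, ubar) within {(t, u, u'). u \<noteq> u'})
          (\<lambda>(t, u, u'). ereal (norm (e t u - e t u') / norm (u - u'))) \<le> ereal \<mu>)"

end

(* With e = f(tbar, .) - h, the second map is the first one plus e, and e is Lipschitz near ubar with
   a constant nu as close to mu as needed. A point v near ubar solves y : h(v) + e(v) + F(v) iff
   v = s(y - e(v)), where s is the single-valued localization of the inverse of h + F. The regularity
   modulus bounds the Lipschitz constant kappa of s, so that nu * kappa < 1 and the contraction
   principle yields a unique solution depending Lipschitz continuously on y. The converse is the same
   argument with -e. *)
theory Submission
  imports Defs
begin

lemma nbhd_iff_ball: "nbhd U x \<longleftrightarrow> (\<exists>e>0. ball x e \<subseteq> U)"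
  by (simp add: nbhd_def mem_interior)

lemma mem_fun_plus_map_iff:
  fixes g :: "'a \<Rightarrow> 'b::group_add"
  shows "y \<in> fun_plus_map g F v \<longleftrightarrow> - g v + y \<in> F v"
  by (force simp: fun_plus_map_def add.assoc [symmetric])

text \<open>This lets each of the two maps of the theorem be written as the other one plus a
  single-valued perturbation.\<close>

lemma fun_plus_map_fun_plus_map:
  fixes g h :: "'a \<Rightarrow> 'b::ab_group_add"
  shows "fun_plus_map g (fun_plus_map h F) = fun_plus_map (\<lambda>v. h v + g v) F"
  by (rule ext) (auto simp: mem_fun_plus_map_iff algebra_simps)

text \<open>Strong regularity alone gives some Lipschitz constant for \<open>s\<close>; the modulus
  is what makes it small. Applying the regularity estimate at \<open>x = s y\<close> with the value
  \<open>y'\<close> bounds the distance from \<open>s y\<close> to \<open>inv_map H y'\<close> by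
  \<open>\<kappa> * dist y' y\<close>, and near \<open>xbar\<close> the only point of
  \<open>inv_map H y'\<close> is \<open>s y'\<close>.\<close>

lemma strongly_metrically_regular_lipschitz_localization:
  fixes H :: "('a::metric_space, 'b::metric_space) setmap"
  assumes smr: "strongly_metrically_regular H xbar ybar"
    and mu: "\<mu> \<ge> 0"
    and reg: "ereal \<mu> * reg_modulus H xbar ybar < 1"
  obtains U V s \<kappa> where "nbhd U xbar" "nbhd V ybar"
    "\<And>y. y \<in> V \<Longrightarrow> inv_map H y \<inter> U = {s y}" "\<kappa>-lipschitz_on V s" "\<mu> * \<kappa> < 1"
proof -
  obtain U V s L where U: "nbhd U xbar" and V: "nbhd V ybar"
    and s: "\<And>y. y \<in> V \<Longrightarrow> inv_map H y \<inter> U = {s y}" and L: "L-lipschitz_on V s"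
    and mem: "ybar \<in> H xbar"
    using smr unfolding strongly_metrically_regular_def gph_def by auto
  show ?thesis
  proof (cases "\<mu> = 0")
    \<comment> \<open>For \<open>\<mu> = 0\<close> the product bound is trivial, so the constant
      \<open>L\<close> from strong regularity serves.\<close>
    case True
    then show ?thesis using that[OF U V s L] by simp
  next
    case False
    with mu have mu: "\<mu> > 0" by simp
    \<comment> \<open>As \<open>\<mu> > 0\<close>, an infinite modulus would make the product
      infinite. An infimum below \<open>1 / \<mu>\<close> then yields an admissible
      \<open>\<kappa>\<close> below \<open>1 / \<mu>\<close>.\<close>
    have "reg_modulus H xbar ybar < ereal (1 / \<mu>)"
      using reg mu by (cases "reg_modulus H xbar ybar") (auto simp: field_simps one_ereal_def)
    then obtain \<kappa> U1 V1 where k: "\<kappa> \<ge> 0" "\<kappa> < 1 / \<mu>" and U1: "nbhd U1 xbar" and V1: "nbhd V1 ybar"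
      and est: "\<And>x y. x \<in> U1 \<Longrightarrow> y \<in> V1 \<Longrightarrow>
        edist_set x (inv_map H y) \<le> ereal \<kappa> * edist_set y (H x)"
      unfolding reg_modulus_def Inf_less_iff by auto
    obtain e where e: "e > 0" "ball xbar e \<subseteq> U \<inter> U1"
      using U U1 by (metis nbhd_def nbhd_iff_ball interior_Int Int_iff)
    obtain d where d: "d > 0" "ball ybar d \<subseteq> V \<inter> V1"
      using V V1 by (metis nbhd_def nbhd_iff_ball interior_Int Int_iff)
    have L0: "L \<ge> 0" using L by (rule lipschitz_on_nonneg)
    \<comment> \<open>The a priori constant \<open>L\<close> only serves to keep \<open>s y\<close>
      within \<open>e / 3\<close> of \<open>xbar\<close>. Using \<open>L + 1\<close> avoids division
      by zero and makes the bound strict.\<close>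
    define \<delta> where "\<delta> = min d (e / (3 * (L + 1)))"
    have \<delta>: "\<delta> > 0" "\<delta> \<le> d" using d e L0 by (auto simp: \<delta>_def)
    have "(L + 1) * \<delta> \<le> (L + 1) * (e / (3 * (L + 1)))"
      using L0 by (intro mult_left_mono) (auto simp: \<delta>_def)
    also have "\<dots> = e / 3" using L0 by (simp add: divide_simps)
    finally have L\<delta>: "(L + 1) * \<delta> \<le> e / 3" .
    have ball_V: "ball ybar \<delta> \<subseteq> V \<inter> V1" using d \<delta> by auto
    have "ybar \<in> V" "xbar \<in> U" using d e by auto
    then have "xbar \<in> inv_map H ybar \<inter> U" using mem by (simp add: inv_map_def)
    then have s0: "s ybar = xbar" using s[OF \<open>ybar \<in> V\<close>] by simp
    have s_near: "dist xbar (s y) < e / 3" if y: "y \<in> ball ybar \<delta>" for y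
    proof -
      have "dist (s ybar) (s y) \<le> L * dist ybar y"
        using y ball_V \<open>ybar \<in> V\<close> by (intro lipschitz_onD[OF L]) auto
      also have "\<dots> \<le> L * \<delta>" using y L0 by (intro mult_left_mono) auto
      also have "\<dots> < (L + 1) * \<delta>" using \<delta> by (simp add: algebra_simps)
      finally show ?thesis using L\<delta> s0 by simp
    qed
    have "\<kappa>-lipschitz_on (ball ybar \<delta>) s"
    proof (rule lipschitz_onI)
      fix y y' assume y: "y \<in> ball ybar \<delta>" and y': "y' \<in> ball ybar \<delta>"
      show "dist (s y) (s y') \<le> \<kappa> * dist y y'"
      \<comment> \<open>The distance to \<open>inv_map H y'\<close> is an infimum that need not be
        attained. Negating the goal puts that infimum strictly below
        \<open>dist (s y) (s y')\<close>, so an actual point \<open>x\<close> of the set lies closer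
        to \<open>s y\<close> than \<open>s y'\<close> does.\<close>
      proof (rule ccontr)
        assume contra: "\<not> ?thesis"
        have "s y \<in> inv_map H y" using s[of y] y ball_V by blast
        then have "y \<in> H (s y)" by (simp add: inv_map_def)
        then have "edist_set y' (H (s y)) \<le> ereal (dist y' y)"
          unfolding edist_set_def by (rule INF_lower)
        then have le: "ereal \<kappa> * edist_set y' (H (s y)) \<le> ereal \<kappa> * ereal (dist y' y)"
          using k by (intro ereal_mult_left_mono) auto
        have "s y \<in> U1" using s_near[OF y] e by auto
        then have "edist_set (s y) (inv_map H y') \<le> ereal \<kappa> * edist_set y' (H (s y))"
          using y' ball_V by (intro est) auto
        also note le
        also have "ereal \<kappa> * ereal (dist y' y) < ereal (dist (s y) (s y'))"
          using contra by (simp add: dist_commute)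
        finally obtain x where x: "x \<in> inv_map H y'" "dist (s y) x < dist (s y) (s y')"
          unfolding edist_set_def INF_less_iff by auto
        \<comment> \<open>The bound ends in three distances, each below \<open>e / 3\<close>, so
          \<open>x\<close> lies in \<open>U\<close>, where \<open>s y'\<close> is the only preimage
          of \<open>y'\<close>.\<close>
        have "dist xbar x \<le> dist xbar (s y) + dist (s y) x" by (rule dist_triangle)
        also have "\<dots> < dist xbar (s y) + dist (s y) (s y')" using x by simp
        also have "\<dots> \<le> dist xbar (s y) + (dist xbar (s y) + dist xbar (s y'))"
          by (simp add: dist_triangle3)
        also have "\<dots> < e" using s_near[OF y] s_near[OF y'] by simp
        finally have "x \<in> U" using e by auto
        then have "x = s y'" using x s[of y'] y' ball_V by blast
        then show False using x by simp
      qed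
    qed (use k in simp)
    moreover have "nbhd (ball ybar \<delta>) ybar" using \<delta> nbhd_iff_ball by blast
    moreover have "\<mu> * \<kappa> < 1" using k mu by (simp add: field_simps)
    moreover have "inv_map H y \<inter> U = {s y}" if "y \<in> ball ybar \<delta>" for y
      using s that ball_V by blast
    ultimately show ?thesis using that U by metis
  qed
qed

text \<open>For fixed \<open>y\<close>, the solutions \<open>v\<close> near \<open>xbar\<close> are
  the fixed points of \<open>v \<mapsto> s (y - g v)\<close>, a contraction with factor
  \<open>\<nu> * \<kappa>\<close>.\<close>

lemma strongly_metrically_regular_lipschitz_perturbation:
  fixes H :: "('a::complete_space, 'b::real_normed_vector) setmap" and g :: "'a \<Rightarrow> 'b"
  assumes mem: "ybar \<in> H xbar"
    and U: "nbhd U xbar" and V: "nbhd V ybar"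
    and s: "\<And>y. y \<in> V \<Longrightarrow> inv_map H y \<inter> U = {s y}" and ks: "\<kappa>-lipschitz_on V s"
    and W: "nbhd W xbar" and g: "\<nu>-lipschitz_on W g" and g0: "g xbar = 0"
    and less: "\<nu> * \<kappa> < 1"
  shows "strongly_metrically_regular (fun_plus_map g H) xbar ybar"
proof -
  have k0: "\<kappa> \<ge> 0" and n0: "\<nu> \<ge> 0"
    using ks g by (auto dest: lipschitz_on_nonneg)
  obtain e where e: "e > 0" "ball xbar e \<subseteq> U \<inter> W"
    using U W by (metis nbhd_def nbhd_iff_ball interior_Int Int_iff)
  obtain d where d: "d > 0" "ball ybar d \<subseteq> V"
    using V nbhd_iff_ball by metis
  have "ybar \<in> V" "xbar \<in> U" "xbar \<in> W" using d e by auto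
  then have "xbar \<in> inv_map H ybar \<inter> U" using mem by (simp add: inv_map_def)
  then have s0: "s ybar = xbar" using s[OF \<open>ybar \<in> V\<close>] by simp
  \<comment> \<open>The radius \<open>a\<close> keeps \<open>v\<close> inside \<open>U\<close> and
    \<open>W\<close> and gives \<open>\<nu> * a < d / 2\<close>; together with
    \<open>b \<le> d / 2\<close> this keeps \<open>y - g v\<close> in \<open>V\<close>.\<close>
  define a where "a = min (e / 2) (d / (2 * (\<nu> + 1)))"
  have a: "a > 0" "a < e" using e d n0 by (auto simp: a_def)
  have "(\<nu> + 1) * a \<le> (\<nu> + 1) * (d / (2 * (\<nu> + 1)))"
    using n0 by (intro mult_left_mono) (auto simp: a_def)
  also have "\<dots> = d / 2" using n0 by (simp add: divide_simps)
  finally have na: "\<nu> * a < d / 2" using a by (simp add: algebra_simps)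
  \<comment> \<open>The second term of the minimum is chosen so that
    \<open>\<kappa> * (b + \<nu> * a) \<le> a\<close>, which makes the fixed-point map send
    \<open>cball xbar a\<close> into itself.\<close>
  define b where "b = min (d / 2) ((1 - \<nu> * \<kappa>) * a / (\<kappa> + 1))"
  have b: "b > 0" using d a less k0 by (simp add: b_def)
  have bd: "b \<le> d / 2" unfolding b_def by (rule min.cobounded1)
  have "(\<kappa> + 1) * b \<le> (\<kappa> + 1) * ((1 - \<nu> * \<kappa>) * a / (\<kappa> + 1))"
    using k0 by (intro mult_left_mono) (auto simp: b_def)
  then have "(\<kappa> + 1) * b \<le> (1 - \<nu> * \<kappa>) * a" using k0 by simp
  then have kb: "\<kappa> * (b + \<nu> * a) \<le> a" using b by (simp add: algebra_simps)
  have sub: "cball xbar a \<subseteq> U \<inter> W" using a e by auto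
  have g_lip: "norm (g v - g w) \<le> \<nu> * dist v w" if "v \<in> cball xbar a" "w \<in> cball xbar a" for v w
    using lipschitz_onD[OF g, of v w] that sub unfolding dist_norm [of "g v"] by blast
  have near: "dist ybar (y - g v) \<le> b + \<nu> * a"
    if y: "y \<in> cball ybar b" and v: "v \<in> cball xbar a" for y v
  proof -
    have "dist ybar (y - g v) = norm ((ybar - y) + g v)"
      by (simp add: dist_norm algebra_simps)
    also have "\<dots> \<le> norm (ybar - y) + norm (g v)" by (rule norm_triangle_ineq)
    also have "norm (g v) \<le> \<nu> * dist v xbar" using g_lip[OF v, of xbar] a g0 by simp
    also have "\<dots> \<le> \<nu> * a" using v n0 by (intro mult_left_mono) (auto simp: dist_commute)
    finally show ?thesis using y by (simp add: dist_norm)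
  qed
  have inV: "y - g v \<in> V" if "y \<in> cball ybar b" "v \<in> cball xbar a" for y v
    using near[OF that] na bd d by auto
  \<comment> \<open>This estimate is used twice: with \<open>y = y'\<close> it gives the
    contraction, and at fixed points it gives the Lipschitz bound for the solution map.\<close>
  have s_lip: "dist (s (y - g v)) (s (y' - g v')) \<le> \<kappa> * dist y y' + \<nu> * \<kappa> * dist v v'"
    if y: "y \<in> cball ybar b" "y' \<in> cball ybar b" and v: "v \<in> cball xbar a" "v' \<in> cball xbar a"
    for y y' v v'
  proof -
    have "norm ((y - g v) - (y' - g v')) = norm ((y - y') - (g v - g v'))"
      by (simp add: algebra_simps)
    also have "\<dots> \<le> norm (y - y') + norm (g v - g v')" by (rule norm_triangle_ineq4)
    also have "\<dots> \<le> dist y y' + \<nu> * dist v v'" using g_lip[OF v] by (simp add: dist_norm)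
    finally have *: "dist (y - g v) (y' - g v') \<le> dist y y' + \<nu> * dist v v'"
      by (simp add: dist_norm)
    have "dist (s (y - g v)) (s (y' - g v')) \<le> \<kappa> * dist (y - g v) (y' - g v')"
      using y v by (intro lipschitz_onD[OF ks] inV)
    also have "\<dots> \<le> \<kappa> * (dist y y' + \<nu> * dist v v')"
      using * k0 by (rule mult_left_mono)
    finally show ?thesis by (simp add: algebra_simps)
  qed
  have ex1: "\<exists>!v. v \<in> cball xbar a \<and> s (y - g v) = v" if y: "y \<in> cball ybar b" for y
  proof -
    have "\<exists>!v\<in>cball xbar a. s (y - g v) = v"
    proof (rule Banach_fix)
      show "complete (cball xbar a)" by (simp add: complete_eq_closed)
      show "cball xbar a \<noteq> {}" using a by simp
      show "0 \<le> \<nu> * \<kappa>" using k0 n0 by simp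
      show "(\<lambda>v. s (y - g v)) ` cball xbar a \<subseteq> cball xbar a"
      proof (clarsimp)
        fix v assume v: "dist xbar v \<le> a"
        have "dist (s ybar) (s (y - g v)) \<le> \<kappa> * dist ybar (y - g v)"
          using \<open>ybar \<in> V\<close> inV y v by (intro lipschitz_onD[OF ks]) auto
        also have "\<dots> \<le> \<kappa> * (b + \<nu> * a)"
          using near y v k0 by (intro mult_left_mono) auto
        finally show "dist xbar (s (y - g v)) \<le> a" using kb s0 by simp
      qed
      show "dist (s (y - g v)) (s (y - g w)) \<le> \<nu> * \<kappa> * dist v w"
        if "v \<in> cball xbar a" "w \<in> cball xbar a" for v w
        using s_lip[OF y y that] by simp
    qed (fact less)
    then show ?thesis by blast
  qed
  define \<sigma> where "\<sigma> y = (THE v. v \<in> cball xbar a \<and> s (y - g v) = v)" for y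
  have \<sigma>: "\<sigma> y \<in> cball xbar a" "s (y - g (\<sigma> y)) = \<sigma> y" if "y \<in> cball ybar b" for y
    using theI'[OF ex1[OF that]] unfolding \<sigma>_def by auto
  have loc: "inv_map (fun_plus_map g H) y \<inter> cball xbar a = {\<sigma> y}" if y: "y \<in> cball ybar b" for y
  proof -
    have "v \<in> inv_map (fun_plus_map g H) y \<longleftrightarrow> s (y - g v) = v" if v: "v \<in> cball xbar a" for v
    proof -
      have "v \<in> inv_map (fun_plus_map g H) y \<longleftrightarrow> v \<in> inv_map H (y - g v) \<inter> U"
        using v sub by (auto simp: inv_map_def mem_fun_plus_map_iff)
      then show ?thesis unfolding s[OF inV[OF y v]] by auto
    qed
    moreover have "v = \<sigma> y" if "v \<in> cball xbar a" "s (y - g v) = v" for v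
      using ex1[OF y] \<sigma>[OF y] that by blast
    ultimately show ?thesis using \<sigma>[OF y] by blast
  qed
  \<comment> \<open>The constant comes from moving the term
    \<open>\<nu> * \<kappa> * dist (\<sigma> y) (\<sigma> y')\<close> to the left and dividing by
    \<open>1 - \<nu> * \<kappa> > 0\<close>.\<close>
  have "(\<kappa> / (1 - \<nu> * \<kappa>))-lipschitz_on (cball ybar b) \<sigma>"
  proof (rule lipschitz_onI)
    fix y y' assume y: "y \<in> cball ybar b" and y': "y' \<in> cball ybar b"
    have "dist (\<sigma> y) (\<sigma> y') \<le> \<kappa> * dist y y' + \<nu> * \<kappa> * dist (\<sigma> y) (\<sigma> y')"
      using s_lip[OF y y' \<sigma>(1)[OF y] \<sigma>(1)[OF y']] \<sigma>(2) y y' by simp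
    then show "dist (\<sigma> y) (\<sigma> y') \<le> \<kappa> / (1 - \<nu> * \<kappa>) * dist y y'"
      using less by (simp add: field_simps)
  qed (use k0 less in simp)
  moreover have "nbhd (cball xbar a) xbar" "nbhd (cball ybar b) ybar"
    unfolding nbhd_iff_ball using a(1) b ball_subset_cball by metis+
  moreover have "(xbar, ybar) \<in> gph (fun_plus_map g H)"
    using mem g0 by (simp add: gph_def mem_fun_plus_map_iff)
  ultimately show ?thesis unfolding strongly_metrically_regular_def using loc
    by (intro conjI exI[of _ "cball xbar a"] exI[of _ "cball ybar b"] exI[of _ \<sigma>]) auto
qed

text \<open>A limit superior below \<open>\<nu>\<close> keeps the difference quotients below
  \<open>\<nu>\<close> near the base triple; only the slice \<open>t = tbar\<close> is
  needed.\<close>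

lemma strict_estimator_lipschitz:
  fixes f :: "'t::metric_space \<times> 'a::real_normed_vector \<Rightarrow> 'b::real_normed_vector"
  assumes est: "strict_estimator f h tbar ubar \<mu>" and \<nu>: "\<mu> < \<nu>" "0 \<le> \<nu>"
  obtains W where "nbhd W ubar" "\<nu>-lipschitz_on W (\<lambda>u. f (tbar, u) - h u)"
proof -
  define e where "e = (\<lambda>t u. f (t, u) - h u)"
  have "Limsup (at (tbar, ubar, ubar) within {(t, u, u'). u \<noteq> u'})
      (\<lambda>(t, u, u'). ereal (norm (e t u - e t u') / norm (u - u'))) < ereal \<nu>"
    using est \<nu> unfolding strict_estimator_def Let_def e_def
    by (metis (no_types, lifting) le_less_trans less_ereal.simps(1))
  then have "\<forall>\<^sub>F p in at (tbar, ubar, ubar) within {(t, u, u'). u \<noteq> u'}.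
      (case p of (t, u, u') \<Rightarrow> ereal (norm (e t u - e t u') / norm (u - u'))) < ereal \<nu>"
    by (rule Limsup_lessD)
  then obtain d where d: "d > 0"
    and lt: "\<And>t u u'. u \<noteq> u' \<Longrightarrow> (t, u, u') \<noteq> (tbar, ubar, ubar) \<Longrightarrow>
       dist (t, u, u') (tbar, ubar, ubar) < d \<Longrightarrow> norm (e t u - e t u') / norm (u - u') < \<nu>"
    unfolding eventually_at by auto
  \<comment> \<open>Half the radius suffices because the product distance is at most the sum of the
    distances of \<open>u\<close> and \<open>u'\<close> to \<open>ubar\<close>.\<close>
  have "\<nu>-lipschitz_on (ball ubar (d / 2)) (e tbar)"
  proof (rule lipschitz_onI)
    fix u u' assume u: "u \<in> ball ubar (d / 2)" and u': "u' \<in> ball ubar (d / 2)"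
    show "dist (e tbar u) (e tbar u') \<le> \<nu> * dist u u'"
    proof (cases "u = u'")
      case False
      have "dist (tbar, u, u') (tbar, ubar, ubar) \<le> dist u ubar + dist u' ubar"
        by (simp add: dist_Pair_Pair sqrt_sum_squares_le_sum)
      also have "\<dots> < d" using u u' by (simp add: dist_commute)
      finally have "norm (e tbar u - e tbar u') / norm (u - u') < \<nu>"
        using False by (intro lt) auto
      then show ?thesis using False by (simp add: dist_norm field_simps)
    qed simp
  qed (fact \<nu>)
  moreover have "nbhd (ball ubar (d / 2)) ubar"
    unfolding nbhd_iff_ball using d half_gt_zero by blast
  ultimately show ?thesis using that unfolding e_def by blast
qed

lemma strongly_metrically_regular_strict_perturbation:
  fixes H :: "('a::complete_space, 'b::real_normed_vector) setmap" and g :: "'a \<Rightarrow> 'b"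
  assumes smr: "strongly_metrically_regular H xbar ybar"
    and mu: "\<mu> \<ge> 0" and reg: "ereal \<mu> * reg_modulus H xbar ybar < 1"
    and g0: "g xbar = 0"
    and lip: "\<And>\<nu>. \<nu> > \<mu> \<Longrightarrow> \<exists>W. nbhd W xbar \<and> \<nu>-lipschitz_on W g"
  shows "strongly_metrically_regular (fun_plus_map g H) xbar ybar"
proof -
  obtain U V s \<kappa> where loc: "nbhd U xbar" "nbhd V ybar"
    "\<And>y. y \<in> V \<Longrightarrow> inv_map H y \<inter> U = {s y}" "\<kappa>-lipschitz_on V s" and k: "\<mu> * \<kappa> < 1"
    using strongly_metrically_regular_lipschitz_localization[OF smr mu reg] by metis
  have k0: "\<kappa> \<ge> 0" using loc(4) by (rule lipschitz_on_nonneg)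
  \<comment> \<open>Lipschitz constants for \<open>g\<close> are available only strictly above
    \<open>\<mu>\<close>. This choice spends part of the slack in
    \<open>\<mu> * \<kappa> < 1\<close>: the factor \<open>\<kappa> / (\<kappa> + 1)\<close> is
    below 1, so \<open>\<nu> * \<kappa> < 1\<close> still holds.\<close>
  define \<nu> where "\<nu> = \<mu> + (1 - \<mu> * \<kappa>) / (\<kappa> + 1)"
  have "\<nu> > \<mu>" using k k0 by (simp add: \<nu>_def)
  have "(1 - \<mu> * \<kappa>) * (\<kappa> / (\<kappa> + 1)) < (1 - \<mu> * \<kappa>) * 1"
    using k k0 by (intro mult_strict_left_mono) auto
  then have "\<nu> * \<kappa> < 1" by (simp add: \<nu>_def distrib_right)
  moreover obtain W where "nbhd W xbar" "\<nu>-lipschitz_on W g" using lip[OF \<open>\<nu> > \<mu>\<close>] by blast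
  moreover have "ybar \<in> H xbar"
    using smr by (simp add: strongly_metrically_regular_def gph_def)
  ultimately show ?thesis
    by (intro strongly_metrically_regular_lipschitz_perturbation[OF _ loc]) (use g0 in auto)
qed

(* In ereal, 0 * \<infinity> = 0, so the two modulus conditions hold automatically when \<mu> = 0. *)
theorem proposition4p2p1:
  fixes f :: "real \<times> (real ^ 'n) \<Rightarrow> real ^ 'n"
    and F :: "(real ^ 'n, real ^ 'n) setmap"
    and h :: "real ^ 'n \<Rightarrow> real ^ 'n"
    and tbar :: real and ubar :: "real ^ 'n" and \<mu> :: real
  assumes "closed (gph F)"
    and "\<mu> \<ge> 0"
    and "strict_estimator f h tbar ubar \<mu>"
    and "ereal \<mu> * reg_modulus (fun_plus_map h F) ubar 0 < 1"
    and "ereal \<mu> * reg_modulus (fun_plus_map (\<lambda>v. f (tbar, v)) F) ubar 0 < 1"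
  shows "strongly_metrically_regular (fun_plus_map h F) ubar 0 \<longleftrightarrow>
         strongly_metrically_regular (fun_plus_map (\<lambda>v. f (tbar, v)) F) ubar 0"
proof -
  define g where "g = (\<lambda>u. f (tbar, u) - h u)"
  have g0: "g ubar = 0" using assms(3) by (simp add: strict_estimator_def g_def)
  have lip: "\<exists>W. nbhd W ubar \<and> \<nu>-lipschitz_on W g" if "\<nu> > \<mu>" for \<nu>
    using strict_estimator_lipschitz[OF assms(3) that] that assms(2) unfolding g_def by fastforce
  then have lip': "\<exists>W. nbhd W ubar \<and> \<nu>-lipschitz_on W (\<lambda>u. - g u)" if "\<nu> > \<mu>" for \<nu>
    using that by simp
  \<comment> \<open>The perturbations \<open>g\<close> and \<open>- g\<close> have the same
    Lipschitz constants, and each direction uses the modulus condition of the map it starts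
    from.\<close>
  have "fun_plus_map (\<lambda>v. f (tbar, v)) F = fun_plus_map g (fun_plus_map h F)"
    and "fun_plus_map h F = fun_plus_map (\<lambda>u. - g u) (fun_plus_map (\<lambda>v. f (tbar, v)) F)"
    by (simp_all add: fun_plus_map_fun_plus_map g_def)
  then show ?thesis
    using strongly_metrically_regular_strict_perturbation[where g = g, OF _ assms(2,4) g0 lip]
      strongly_metrically_regular_strict_perturbation[where g = "\<lambda>u. - g u", OF _ assms(2,5) _ lip'] g0
    by auto
qed

end
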